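(* Let $B\in\{1,\dots,9\}$, let $\tilde p\neq0$ be an integer and $\tilde q$ a positive integer with $\tilde q\geqslant 20\sqrt[3]{|\tilde p|}$. Put $$F_2=B^{2}\tilde q^{6}-2B\tilde q^{4}-2B\tilde p\tilde q^{3}-2\tilde q^{2}+2\tilde p\tilde q+\tilde p^{2}-\frac5B-\frac{20}{B^{2}\tilde q^{2}}.$$ Then the equation $\tilde Q(t)=0$ has at least one real root $t$ with $F_2<t<F_2-\frac{10\tilde p}{B^{2}\tilde q^{3}}$ in the case $\tilde p<0$, respectively with $F_2-\frac{10\tilde p}{B^{2}\tilde q^{3}}<t<F_2$ in the case $\tilde p>0$.
   Context: For numbers $p,q$ let $$Q_{pq}(t)=t^{10}+(2q^{2}+p^{2})(3q^{2}-2p^{2})\,t^{8}+(q^{8}+10p^{2}q^{6}+4p^{4}q^{4}-14p^{6}q^{2}+p^{8})\,t^{6}-p^{2}q^{2}(q^{8}-14p^{2}q^{6}+4p^{4}q^{4}+10p^{6}q^{2}+p^{8})\,t^{4}-p^{6}q^{6}(q^{2}+2p^{2})(3p^{2}-2q^{2})\,t^{2}-q^{10}p^{10}.$$ Given $B$, $\tilde p$, $\tilde q$, define $\tilde Q(t)=Q_{pq}(t)$ with $p=B\tilde q^{3}-\tilde p$ and $q=\tilde q$. *)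

theory Defs
  imports Complex_Main
begin

definition Q :: "real \<Rightarrow> real \<Rightarrow> real \<Rightarrow> real" where
  "Q p q t =
     t^10
     + (2*q^2 + p^2) * (3*q^2 - 2*p^2) * t^8
     + (q^8 + 10*p^2*q^6 + 4*p^4*q^4 - 14*p^6*q^2 + p^8) * t^6
     - p^2*q^2 * (q^8 - 14*p^2*q^6 + 4*p^4*q^4 + 10*p^6*q^2 + p^8) * t^4
     - p^6*q^6 * (q^2 + 2*p^2) * (3*p^2 - 2*q^2) * t^2
     - q^10 * p^10"

definition Q_tilde :: "real \<Rightarrow> real \<Rightarrow> real \<Rightarrow> real \<Rightarrow> real" where
  "Q_tilde B p' q' t = Q (B * q'^3 - p') q' t"

definition F2 :: "real \<Rightarrow> real \<Rightarrow> real \<Rightarrow> real" where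
  "F2 B p' q' =
     B^2*q'^6 - 2*B*q'^4 - 2*B*p'*q'^3 - 2*q'^2 + 2*p'*q' + p'^2
     - 5/B - 20 / (B^2*q'^2)"

end

theory Submission
  imports Defs
begin

text \<open>
  Write \<open>P = B q'\<^sup>3 - p'\<close> and \<open>a = q'/P\<close>. By homogeneity
  \<open>Q P q' (P\<^sup>2 m) = P\<^sup>2\<^sup>0 Q 1 a m\<close>. As a polynomial in \<open>s = m\<^sup>2\<close>, \<open>Q 1 a m\<close> is a quintic with a
  root \<open>s = 1 - 4a - 2a\<^sup>3 - 16a\<^sup>4 - (107/2)a\<^sup>5 - \<dots>\<close>, which for \<open>a \<le> 1/399\<close> is bracketed by replacing
  the coefficient \<open>107/2\<close> by 50 or by 60. Taking square roots,
  \<open>m = 1 - 2a - 2a\<^sup>2 - 5a\<^sup>3 - 20a\<^sup>4 - c a\<^sup>5\<close> for some \<open>75 \<le> c \<le> 81\<close>, and comparing the powers of \<open>a\<close>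
  with those of \<open>1/(B q'\<^sup>2)\<close> puts \<open>t = P\<^sup>2 m\<close> inside the claimed interval.
\<close>

definition Q_sq :: "real \<Rightarrow> real \<Rightarrow> real" where
  "Q_sq a s =
     ((((s + (2*a^2 + 1) * (3*a^2 - 2)) * s
       + (a^8 + 10*a^6 + 4*a^4 - 14*a^2 + 1)) * s
       - a^2 * (a^8 - 14*a^6 + 4*a^4 + 10*a^2 + 1)) * s
       - a^6 * (a^2 + 2) * (3 - 2*a^2)) * s
       - a^10"

definition sq_approx :: "real \<Rightarrow> real \<Rightarrow> real" where
  "sq_approx k a = 1 - 4*a - 2*a^3 - 16*a^4 - k*a^5"

definition root_approx :: "real \<Rightarrow> real \<Rightarrow> real" where
  "root_approx c a = 1 - 2*a - 2*a^2 - 5*a^3 - 20*a^4 - c*a^5"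

lemma Q_eq_Q_sq: "Q k (k * a) (k^2 * m) = k^20 * Q_sq a (m^2)"
  unfolding Q_def Q_sq_def by algebra

text \<open>The triangle inequality turns the bound of a remainder polynomial with coefficients
  \<open>cs\<close> into one numeric evaluation. The later choice \<open>r = 1/10\<close> is crude
  for \<open>a \<le> 1/399\<close>, but suffices.\<close>

lemma abs_horner_sum_le:
  fixes a r :: real
  assumes "\<bar>a\<bar> \<le> r"
  shows "\<bar>horner_sum id a cs\<bar> \<le> horner_sum abs r cs"
proof (induction cs)
  case (Cons c cs)
  have "\<bar>a * horner_sum id a cs\<bar> \<le> r * horner_sum abs r cs"
    unfolding abs_mult using assms Cons.IH by (intro mult_mono) linarith+
  thus ?case
    unfolding horner_sum_simps id_apply by linarith
qed simp

text \<open>At \<open>a = 0\<close> the quintic is \<open>s^3 * (s - 1)^2\<close>. Only even powers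
  of \<open>a\<close> occur in it, so the double root splits symmetrically into roots near
  \<open>1 - 4*a\<close> and \<open>1 + 4*a\<close>, and the derivative in \<open>s\<close> at the
  first is about \<open>-8*a\<close>. As \<open>sq_approx k a\<close> misses that root by about
  \<open>-(k - 107/2) * a^5\<close>, the value there starts with
  \<open>8 * (k - 107/2) * a^6\<close>: the coefficient is -28 for \<open>k = 50\<close> and 52 for
  \<open>k = 60\<close>. The tail \<open>cs\<close> adds at most 5000/399 < 13 to it.\<close>

lemma Q_sq_approx_50_neg:
  assumes "0 < a" "a \<le> 1 / 399"
  shows "Q_sq a (sq_approx 50 a) < 0"
proof -
  define cs :: "real list" where "cs =
    [-1584, 13060, -25560, 10724, 54488, -13084, -1099672, -177124, -2333320,
     -10889252, -23559784, -22090020, -69091288, -146750356, -183412200, -159730000,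
     -334625000, -462500000, -312500000]"
  have expand: "Q_sq a (sq_approx 50 a) = a^6 * (-28 + a * horner_sum id a cs)"
    unfolding Q_sq_def sq_approx_def cs_def horner_sum_simps id_apply
    by algebra
  have "\<bar>horner_sum id a cs\<bar> \<le> horner_sum abs (1/10) cs"
    using assms by (intro abs_horner_sum_le) auto
  also have "\<dots> \<le> 5000"
    unfolding cs_def by simp
  finally have "\<bar>a\<bar> * \<bar>horner_sum id a cs\<bar> \<le> 1 / 399 * 5000"
    using assms by (intro mult_mono) auto
  hence "\<bar>a * horner_sum id a cs\<bar> < 28"
    by (simp add: abs_mult)
  hence "- 28 + a * horner_sum id a cs < 0"
    by linarith
  thus ?thesis
    using assms unfolding expand by (simp add: mult_less_0_iff zero_less_mult_iff)
qed

lemma Q_sq_approx_60_pos: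
  assumes "0 < a" "a \<le> 1 / 399"
  shows "0 < Q_sq a (sq_approx 60 a)"
proof -
  define cs :: "real list" where "cs =
    [-2544, 16860, -31000, 10344, 60448, 129256, -1570912, -69564, -2299360,
     -13555572, -37676904, -28241440, -98542288, -240536336, -344655840, -255283200,
     -599832000, -959040000, -777600000]"
  have expand: "Q_sq a (sq_approx 60 a) = a^6 * (52 + a * horner_sum id a cs)"
    unfolding Q_sq_def sq_approx_def cs_def horner_sum_simps id_apply
    by algebra
  have "\<bar>horner_sum id a cs\<bar> \<le> horner_sum abs (1/10) cs"
    using assms by (intro abs_horner_sum_le) auto
  also have "\<dots> \<le> 5000"
    unfolding cs_def by simp
  finally have "\<bar>a\<bar> * \<bar>horner_sum id a cs\<bar> \<le> 1 / 399 * 5000"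
    using assms by (intro mult_mono) auto
  hence "\<bar>a * horner_sum id a cs\<bar> < 52"
    by (simp add: abs_mult)
  hence "0 < 52 + a * horner_sum id a cs"
    by linarith
  thus ?thesis
    using assms unfolding expand by (simp add: mult_less_0_iff zero_less_mult_iff)
qed

text \<open>Squaring \<open>root_approx c a\<close> reproduces \<open>sq_approx\<close> up to degree
  4 and gives \<open>100 - 2*c\<close> as coefficient of \<open>a^5\<close>, so
  \<open>c = 75\<close> matches \<open>k = 50\<close> exactly.\<close>

lemma root_approx_75_sq_ge:
  assumes "0 < a"
  shows "sq_approx 50 a \<le> (root_approx 75 a)^2"
proof -
  have "(root_approx 75 a)^2 =
      sq_approx 50 a + a^6 * (405 + 500*a + 1150*a^2 + 3000*a^3 + 5625*a^4)"
    unfolding root_approx_def sq_approx_def by algebra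
  thus ?thesis
    using assms by simp
qed

text \<open>Here \<open>c = 80\<close> would match \<open>k = 60\<close>, but leave a positive term
  in \<open>a^6\<close>. With \<open>c = 81\<close> the surplus \<open>-2 * a^5\<close> absorbs all
  higher terms.\<close>

lemma root_approx_81_sq_le:
  assumes "0 < a" "a \<le> 1 / 399"
  shows "(root_approx 81 a)^2 \<le> sq_approx 60 a"
proof -
  define cs :: "real list" where "cs = [429, 524, 1210, 3240, 6561]"
  have expand: "(root_approx 81 a)^2 = sq_approx 60 a - a^5 * (2 - a * horner_sum id a cs)"
    unfolding root_approx_def sq_approx_def cs_def horner_sum_simps id_apply by algebra
  have "\<bar>horner_sum id a cs\<bar> \<le> horner_sum abs (1/10) cs"
    using assms by (intro abs_horner_sum_le) auto
  also have "\<dots> \<le> 700"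
    unfolding cs_def by simp
  finally have "\<bar>a\<bar> * \<bar>horner_sum id a cs\<bar> \<le> 1 / 399 * 700"
    using assms by (intro mult_mono) auto
  hence "0 \<le> 2 - a * horner_sum id a cs"
    unfolding abs_mult[symmetric] by linarith
  thus ?thesis
    using assms unfolding expand by simp
qed

lemma root_approx_75_nonneg:
  assumes "0 < a" "a \<le> 1 / 399"
  shows "0 \<le> root_approx 75 a"
proof -
  define cs :: "real list" where "cs = [2, 2, 5, 20, 75]"
  have expand: "root_approx 75 a = 1 - a * horner_sum id a cs"
    unfolding root_approx_def cs_def horner_sum_simps id_apply by algebra
  have "\<bar>horner_sum id a cs\<bar> \<le> horner_sum abs (1/10) cs"
    using assms by (intro abs_horner_sum_le) auto
  also have "\<dots> \<le> 3"
    unfolding cs_def by simp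
  finally have "\<bar>a\<bar> * \<bar>horner_sum id a cs\<bar> \<le> 1 / 399 * 3"
    using assms by (intro mult_mono) auto
  thus ?thesis
    unfolding expand abs_mult[symmetric] by linarith
qed

text \<open>For the root bounds and for \<open>F2\<close>, what is subtracted from
  \<open>P^2 - 2*P*q - 2*q^2\<close> is \<open>q^2\<close> times an expression in \<open>a\<close>
  or \<open>b\<close> as below. The relation says \<open>1/b - 1/a = u\<close>, so
  \<open>5*(a - b)\<close> is about \<open>5*u*b^2\<close>, half of the permitted
  \<open>10*u*b^2\<close>. The quadratic terms change little, and
  \<open>20*b \<le> \<bar>u\<bar>\<close> keeps the cubic term near or below
  \<open>(81/20) * \<bar>u\<bar> * b^2\<close>.\<close>

lemma correction_bounds:
  fixes a b u :: real
  assumes a: "a = b + u * a * b" "0 < a" and b: "0 < b" "b \<le> 1 / 400"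
    and u: "\<bar>u\<bar> * b \<le> 1 / 8000" "20 * b \<le> \<bar>u\<bar>"
  shows "u < 0 \<Longrightarrow> 5*a + 20*a^2 + 81*a^3 < 5*b + 20*b^2"
    and "u < 0 \<Longrightarrow> 5*b + 20*b^2 + 10*u*b^2 < 5*a + 20*a^2 + 75*a^3"
    and "u > 0 \<Longrightarrow> 5*b + 20*b^2 < 5*a + 20*a^2 + 75*a^3"
    and "u > 0 \<Longrightarrow> 5*a + 20*a^2 + 81*a^3 < 5*b + 20*b^2 + 10*u*b^2"
proof -
  have ab: "a - b = u * a * b"
    using a by simp
  have sq: "a^2 - b^2 = u * a * b * (a + b)"
    using ab by algebra
  {
    assume neg: "u < 0"
    hence "a < b"
      using ab a(2) b(1) mult_pos_pos[of "-u" "a * b"] by (simp add: mult.assoc)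
    have "a^2 < b^2"
      using \<open>a < b\<close> a(2) by (intro power_strict_mono) auto
    have "81 * a^3 = 81 * a * a * a"
      by (simp add: power3_eq_cube)
    also have "\<dots> \<le> 81 * b * a * b"
      using \<open>a < b\<close> a(2) by (intro mult_mono) auto
    \<comment> \<open>The right side is \<open>5*(b - a)\<close>, the gain in the linear term; the
      bound holds as 81/20 < 5.\<close>
    also have "\<dots> \<le> 5 * (- u) * a * b"
      using u neg a(2) b by (intro mult_right_mono) auto
    finally show "5*a + 20*a^2 + 81*a^3 < 5*b + 20*b^2"
      using ab \<open>a^2 < b^2\<close> by (simp add: algebra_simps)
    have "b^2 - a^2 = - u * a * b * (a + b)"
      using sq by (simp add: algebra_simps)
    also have "\<dots> \<le> - u * b * b * (1/200)"
      using neg \<open>a < b\<close> a(2) b by (intro mult_mono) (auto simp: mult_nonpos_nonneg)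
    finally have "b^2 - a^2 \<le> - u * b^2 / 200"
      by (simp add: power2_eq_square)
    moreover have "- u * a * b \<le> - u * b * b"
      using neg \<open>a < b\<close> a(2) b by (intro mult_mono) (auto simp: mult_nonpos_nonneg)
    hence "b - a \<le> - u * b^2"
      using ab by (simp add: power2_eq_square)
    moreover have "0 < - u * b^2"
      using neg b(1) by (simp add: mult_neg_pos)
    moreover have "0 < a^3"
      using a(2) by simp
    ultimately show "5*b + 20*b^2 + 10*u*b^2 < 5*a + 20*a^2 + 75*a^3"
      by linarith
  next
    assume pos: "u > 0"
    hence "b < a"
      using ab mult_pos_pos[OF mult_pos_pos[OF pos a(2)] b(1)] by linarith
    hence "b^2 < a^2"
      using b(1) by (intro power_strict_mono) auto
    moreover have "0 < a^3"
      using a(2) by simp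
    ultimately show "5*b + 20*b^2 < 5*a + 20*a^2 + 75*a^3"
      using \<open>b < a\<close> by linarith
    \<comment> \<open>Inserted into \<open>a - b = u*a*b\<close>, this bounds \<open>a\<close> by a
      multiple of \<open>b\<close>.\<close>
    have "u * b * a \<le> 1 / 8000 * a"
      using u pos a(2) by (intro mult_right_mono) auto
    hence "a \<le> (8000/7999) * b"
      using ab by (simp add: algebra_simps)
    hence a_le: "a \<le> (1001/1000) * b"
      using b(1) by linarith
    have ub: "0 < u * b^2"
      using pos b(1) by simp
    have "u * b * a \<le> u * b * ((1001/1000) * b)"
      using a_le pos b(1) by (intro mult_left_mono) auto
    hence 1: "a - b \<le> (1001/1000) * (u * b^2)"
      using ab by (simp add: power2_eq_square algebra_simps)
    have "a^2 - b^2 = (a - b) * (a + b)"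
      by (simp add: power2_eq_square algebra_simps)
    also have "\<dots> \<le> ((1001/1000) * (u * b^2)) * (1/100)"
      using 1 ub a_le a(2) b \<open>b < a\<close> by (intro mult_mono) auto
    finally have 2: "a^2 - b^2 \<le> (1001/100000) * (u * b^2)"
      by simp
    have "a^3 \<le> ((1001/1000) * b)^3"
      using a_le a(2) by (intro power_mono) auto
    also have "\<dots> = (1001/1000)^3 * (b * b^2)"
      by (simp add: power3_eq_cube power2_eq_square)
    also have "\<dots> \<le> (1001/1000)^3 * (u / 20 * b^2)"
      using u pos by (intro mult_left_mono mult_right_mono) auto
    finally have "81 * a^3 \<le> (41/10) * (u * b^2)"
      using ub by (simp add: power3_eq_cube)
    \<comment> \<open>In units of \<open>u * b^2\<close>, the linear, quadratic and cubic terms cost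
      at most 5.005 + 0.2002 + 4.1 < 10.\<close>
    with 1 2 ub show "5*a + 20*a^2 + 81*a^3 < 5*b + 20*b^2 + 10*u*b^2"
      by (simp add: algebra_simps)
  }
qed

lemma exists_root_between_approximations:
  fixes P q :: real
  assumes "0 < P" "0 < q" "q / P \<le> 1 / 399"
  obtains t where "Q P q t = 0"
    "P^2 * root_approx 81 (q/P) \<le> t" "t \<le> P^2 * root_approx 75 (q/P)"
proof -
  define a where "a = q / P"
  have a: "0 < a" "a \<le> 1/399"
    using assms by (auto simp: a_def)
  have "sq_approx 60 a \<le> sq_approx 50 a"
    using a by (simp add: sq_approx_def)
  moreover have "\<forall>s. sq_approx 60 a \<le> s \<and> s \<le> sq_approx 50 a \<longrightarrow> isCont (Q_sq a) s"
    unfolding Q_sq_def by (intro allI impI continuous_intros)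
  ultimately obtain s where s: "sq_approx 60 a \<le> s" "s \<le> sq_approx 50 a" "Q_sq a s = 0"
    using IVT2[of "Q_sq a" "sq_approx 50 a" 0 "sq_approx 60 a"]
      Q_sq_approx_50_neg[OF a] Q_sq_approx_60_pos[OF a] by auto
  have lower: "(root_approx 81 a)^2 \<le> s"
    using root_approx_81_sq_le[OF a] s by linarith
  have "0 \<le> s"
    using lower zero_le_power2[of "root_approx 81 a"] by linarith
  hence "Q_sq a ((sqrt s)^2) = 0"
    using s by simp
  moreover have "P * a = q"
    using assms by (simp add: a_def)
  ultimately have "Q P q (P^2 * sqrt s) = 0"
    using Q_eq_Q_sq[of P a "sqrt s"] by simp
  moreover have "root_approx 81 a \<le> sqrt s"
    using lower by (rule real_le_rsqrt)
  hence "P^2 * root_approx 81 a \<le> P^2 * sqrt s"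
    by (intro mult_left_mono) auto
  moreover have "sqrt s \<le> root_approx 75 a"
    using root_approx_75_nonneg[OF a] root_approx_75_sq_ge[OF a(1)] s
    by (intro real_le_lsqrt) auto
  hence "P^2 * sqrt s \<le> P^2 * root_approx 75 a"
    by (intro mult_left_mono) auto
  ultimately show thesis
    using that unfolding a_def by blast
qed

text \<open>Integrality of \<open>B\<close> and \<open>p'\<close> enters as the lower bounds
  \<open>1 \<le> \<beta>\<close> and \<open>1 \<le> \<bar>p\<bar>\<close>.\<close>

lemma Q_tilde_root_near_F2:
  fixes \<beta> p q :: real
  assumes beta: "1 \<le> \<beta>" and p: "1 \<le> \<bar>p\<bar>" and q_root: "20 * root 3 \<bar>p\<bar> \<le> q"
  shows "(p < 0 \<longrightarrow> (\<exists>t. Q_tilde \<beta> p q t = 0 \<and> F2 \<beta> p q < t \<and>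
           t < F2 \<beta> p q - 10 * p / (\<beta>^2 * q^3))) \<and>
         (p > 0 \<longrightarrow> (\<exists>t. Q_tilde \<beta> p q t = 0 \<and>
           F2 \<beta> p q - 10 * p / (\<beta>^2 * q^3) < t \<and> t < F2 \<beta> p q))"
proof -
  \<comment> \<open>\<open>b\<close> is the value of \<open>a\<close> with \<open>p\<close> dropped
    from \<open>P\<close>, and \<open>u\<close> is the resulting change
    \<open>1/b - 1/a\<close>.\<close>
  define P a b u where "P = \<beta> * q^3 - p" and "a = q / P"
    and "b = 1 / (\<beta> * q^2)" and "u = p / q"
  have "1 \<le> root 3 \<bar>p\<bar>"
    using p by simp
  hence q: "20 \<le> q"
    using q_root by linarith
  have "(20 * root 3 \<bar>p\<bar>)^3 \<le> q^3"
    using q_root by (intro power_mono) auto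
  hence p_le: "8000 * \<bar>p\<bar> \<le> q^3"
    by (simp add: power_mult_distrib)
  have "1 * q^3 \<le> \<beta> * q^3"
    using beta q by (intro mult_right_mono) auto
  hence bq3: "q^3 \<le> \<beta> * q^3"
    by simp
  have "20^2 \<le> q^2"
    using q by (intro power_mono) auto
  hence q2: "400 \<le> q^2"
    by simp
  have "1 * q^2 \<le> \<beta> * q^2"
    using beta by (intro mult_right_mono) auto
  hence bq2: "q^2 \<le> \<beta> * q^2"
    by simp
  have q3: "400 * q \<le> q^3"
    using q2 q by (simp add: power3_eq_cube power2_eq_square)
  \<comment> \<open>Source of 1/399: \<open>P\<close> is at least \<open>(1 - 1/8000) * q^3\<close>,
    and \<open>q^3 \<ge> 400 * q\<close>.\<close>
  have P_ge: "399 * q \<le> P"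
    using p_le bq3 q3 q unfolding P_def by linarith
  hence P: "0 < P"
    using q by linarith
  have a: "0 < a" "a \<le> 1 / 399"
    using P P_ge q by (auto simp: a_def field_simps)
  have b: "0 < b" "b \<le> 1 / 400"
    using q2 bq2 by (auto simp: b_def field_simps)
  have ab: "a = b + u * a * b"
    using P q beta by (simp add: a_def b_def u_def P_def field_simps power3_eq_cube power2_eq_square)
  have "\<bar>u\<bar> * b = \<bar>p\<bar> / (\<beta> * q^3)"
    using q by (simp add: u_def b_def power3_eq_cube power2_eq_square mult_ac)
  also have "\<dots> \<le> 1 / 8000"
    using order_trans[OF p_le bq3] q beta by (simp add: field_simps)
  finally have ub: "\<bar>u\<bar> * b \<le> 1 / 8000" .
  have "20 * b \<le> 20 / q^2"
    using bq2 q2 beta q by (simp add: b_def field_simps)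
  also have "\<dots> \<le> 1 / q"
    using q by (simp add: field_simps power2_eq_square)
  also have "\<dots> \<le> \<bar>u\<bar>"
    using p q by (simp add: u_def divide_right_mono)
  finally have bu: "20 * b \<le> \<bar>u\<bar>" .
  note bounds = correction_bounds[OF ab a(1) b ub bu]
  obtain t where t: "Q P q t = 0" "P^2 * root_approx 81 a \<le> t" "t \<le> P^2 * root_approx 75 a"
    using exists_root_between_approximations[of P q] P q a unfolding a_def by auto
  have Pa: "P * a = q"
    using P by (simp add: a_def)
  have approx: "P^2 * root_approx c a = P^2 - 2*P*q - 2*q^2 - q^2 * (5*a + 20*a^2 + c*a^3)" for c
    unfolding root_approx_def Pa[symmetric] by algebra
  \<comment> \<open>Thus \<open>F2\<close> is the truncated expansion without its cubic term and
    with \<open>a\<close> replaced by \<open>b\<close>.\<close>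
  have F2: "F2 \<beta> p q = P^2 - 2*P*q - 2*q^2 - q^2 * (5*b + 20*b^2)"
    using q beta by (simp add: F2_def P_def b_def field_simps) algebra
  have width: "10 * p / (\<beta>^2 * q^3) = q^2 * (10*u*b^2)"
    using q beta by (simp add: u_def b_def field_simps) algebra
  have F2': "F2 \<beta> p q - 10 * p / (\<beta>^2 * q^3) =
      P^2 - 2*P*q - 2*q^2 - q^2 * (5*b + 20*b^2 + 10*u*b^2)"
    unfolding F2 width by (simp add: algebra_simps)
  have mono: "X - q^2 * y < X - q^2 * x" if "x < y" for x y X
    using that q by simp
  have root: "Q_tilde \<beta> p q t = 0"
    using t(1) by (simp add: Q_tilde_def P_def)
  show ?thesis
  proof (intro conjI impI exI[of _ t] root)
    assume "p < 0"
    hence "u < 0"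
      using q by (simp add: u_def divide_neg_pos)
    have "F2 \<beta> p q < P^2 * root_approx 81 a"
      unfolding F2 approx by (rule mono[OF bounds(1)[OF \<open>u < 0\<close>]])
    thus "F2 \<beta> p q < t"
      using t by linarith
    have "P^2 * root_approx 75 a < F2 \<beta> p q - 10 * p / (\<beta>^2 * q^3)"
      unfolding F2' approx by (rule mono[OF bounds(2)[OF \<open>u < 0\<close>]])
    thus "t < F2 \<beta> p q - 10 * p / (\<beta>^2 * q^3)"
      using t by linarith
  next
    assume "p > 0"
    hence "u > 0"
      using q by (simp add: u_def)
    have "F2 \<beta> p q - 10 * p / (\<beta>^2 * q^3) < P^2 * root_approx 81 a"
      unfolding F2' approx by (rule mono[OF bounds(4)[OF \<open>u > 0\<close>]])
    thus "F2 \<beta> p q - 10 * p / (\<beta>^2 * q^3) < t"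
      using t by linarith
    have "P^2 * root_approx 75 a < F2 \<beta> p q"
      unfolding F2 approx by (rule mono[OF bounds(3)[OF \<open>u > 0\<close>]])
    thus "t < F2 \<beta> p q"
      using t by linarith
  qed
qed

theorem theorem4p2:
  fixes B p' q' :: int
  assumes "B \<in> {1..9}"
    and "p' \<noteq> 0"
    and "q' > 0"
    and "real_of_int q' \<ge> 20 * root 3 \<bar>real_of_int p'\<bar>"
  shows "(p' < 0 \<longrightarrow>
            (\<exists>t::real. Q_tilde (of_int B) (of_int p') (of_int q') t = 0 \<and>
               F2 (of_int B) (of_int p') (of_int q') < t \<and>
               t < F2 (of_int B) (of_int p') (of_int q')
                     - 10 * of_int p' / ((of_int B)^2 * (of_int q')^3))) \<and>
         (p' > 0 \<longrightarrow>
            (\<exists>t::real. Q_tilde (of_int B) (of_int p') (of_int q') t = 0 \<and>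
               F2 (of_int B) (of_int p') (of_int q')
                 - 10 * of_int p' / ((of_int B)^2 * (of_int q')^3) < t \<and>
               t < F2 (of_int B) (of_int p') (of_int q')))"
  using Q_tilde_root_near_F2[of "of_int B" "of_int p'" "of_int q'"] assms by simp

end
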